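(* Let $F=f+g$ on $\mathbb{R}^d$, where $f:\mathbb{R}^d\to\mathbb{R}$ is continuously differentiable and $L$-smooth, $g:\mathbb{R}^d\to\mathbb{R}\cup\{+\infty\}$ is proper, closed and convex, and the set of minimizers of $F$ is nonempty with finite minimum value $F^*$. Let $\mathcal{K}\subseteq\mathbb{R}^d$ and assume $F$ satisfies the $\mathcal{K}$-restricted proximal PL inequality with constant $\nu_{\mathcal{K}}>0$. Let $\{x_k\}_{k\ge0}$ be the iterates of the proximal gradient method with step size $1/L$. If $x_k\in\mathcal{K}$ for all $k\ge T$ and if $\nu_{\mathcal{K}}\le L$, then for all $k\ge T$, $$F(x_k)-F^*\le\left(1-\frac{\nu_{\mathcal{K}}}{L}\right)^{k-T}\bigl(F(x_T)-F^*\bigr).$$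
   Context: $L$-smooth (with $L>0$) means $\|\nabla f(x)-\nabla f(y)\|_2\le L\|x-y\|_2$ for all $x,y\in\mathbb{R}^d$. The function $f$ need not be convex. $T\ge 0$ is an integer. For $\lambda>0$, $\operatorname{prox}_{\lambda g}(x):=\operatorname{argmin}_{y\in\mathbb{R}^d}\{g(y)+\frac{1}{2\lambda}\|y-x\|_2^2\}$. The proximal gradient method with step size $1/L$ is $x_{k+1}=\operatorname{prox}_{g/L}\left(x_k-\frac1L\nabla f(x_k)\right)$, started at some $x_0\in\mathbb{R}^d$. Generalized gradient size: for $\alpha>0$, $$\mathcal{D}_g(x,\alpha):=-2\alpha\min_{y\in\mathbb{R}^d}\left[\langle\nabla f(x),y-x\rangle+\frac{\alpha}{2}\|y-x\|_2^2+g(y)-g(x)\right].$$ $F$ satisfies the $\mathcal{K}$-restricted proximal PL inequality with constant $\nu_{\mathcal{K}}>0$ if $\frac12\mathcal{D}_g(x,L)\ge\nu_{\mathcal{K}}(F(x)-F^* )$ for all $x\in\mathcal{K}\cap\operatorname{dom}(F)$, where $\operatorname{dom}(F)=\{x: F(x)<+\infty\}$. Convention: the right-hand side of the claimed inequality is interpreted as $+\infty$ when $F(x_T)=+\infty$. *)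

theory Defs
  imports "HOL-Analysis.Analysis"
begin

definition epi :: "(real ^ 'd \<Rightarrow> ereal) \<Rightarrow> ((real ^ 'd) \<times> real) set" where
  "epi g = {(x, t). g x \<le> ereal t}"

definition eff_dom :: "(real ^ 'd \<Rightarrow> ereal) \<Rightarrow> (real ^ 'd) set" where
  "eff_dom F = {x. F x < \<infinity>}"

definition proper_fun :: "(real ^ 'd \<Rightarrow> ereal) \<Rightarrow> bool" where
  "proper_fun g \<longleftrightarrow> (\<forall>x. g x \<noteq> -\<infinity>) \<and> eff_dom g \<noteq> {}"

text \<open>Closed means that the epigraph is closed, i.e. lower semicontinuity.\<close>

definition closed_fun :: "(real ^ 'd \<Rightarrow> ereal) \<Rightarrow> bool" where
  "closed_fun g \<longleftrightarrow> closed (epi g)"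

definition convex_fun :: "(real ^ 'd \<Rightarrow> ereal) \<Rightarrow> bool" where
  "convex_fun g \<longleftrightarrow> convex (epi g)"

definition composite :: "(real ^ 'd \<Rightarrow> real) \<Rightarrow> (real ^ 'd \<Rightarrow> ereal) \<Rightarrow> real ^ 'd \<Rightarrow> ereal" where
  "composite f g x = ereal (f x) + g x"

text \<open>For proper closed convex \<open>g\<close> and \<open>lam > 0\<close> the minimizer exists and is unique, so the
  choice made by \<^const>\<open>arg_min\<close> is immaterial.\<close>

definition prox :: "real \<Rightarrow> (real ^ 'd \<Rightarrow> ereal) \<Rightarrow> real ^ 'd \<Rightarrow> real ^ 'd" where
  "prox lam g x = arg_min (\<lambda>y. g y + ereal (1 / (2 * lam) * (norm (y - x))\<^sup>2)) (\<lambda>_. True)"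

definition prox_grad_iterates ::
  "real \<Rightarrow> (real ^ 'd \<Rightarrow> real ^ 'd) \<Rightarrow> (real ^ 'd \<Rightarrow> ereal) \<Rightarrow> (nat \<Rightarrow> real ^ 'd) \<Rightarrow> bool" where
  "prox_grad_iterates L gradf g x \<longleftrightarrow>
     (\<forall>k. x (Suc k) = prox (1 / L) g (x k - (1 / L) *\<^sub>R gradf (x k)))"

text \<open>The generalized gradient size, with the gradient of the smooth part passed as \<open>gradf\<close>.
  For \<open>x\<close> in the domain of a proper closed convex \<open>g\<close> and \<open>\<alpha> > 0\<close> the infimum is an attained,
  finite minimum; the value at points with \<open>g x = \<infinity>\<close> is an artefact of \<^typ>\<open>ereal\<close>
  arithmetic and is never used.\<close>

definition gen_grad_size ::
  "(real ^ 'd \<Rightarrow> real ^ 'd) \<Rightarrow> (real ^ 'd \<Rightarrow> ereal) \<Rightarrow> real ^ 'd \<Rightarrow> real \<Rightarrow> ereal" where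
  "gen_grad_size gradf g x \<alpha> =
     ereal (- 2 * \<alpha>) *
       (INF y. ereal (gradf x \<bullet> (y - x) + \<alpha> / 2 * (norm (y - x))\<^sup>2) + g y - g x)"

definition restricted_prox_PL ::
  "(real ^ 'd) set \<Rightarrow> real \<Rightarrow> real \<Rightarrow> (real ^ 'd \<Rightarrow> real) \<Rightarrow> (real ^ 'd \<Rightarrow> real ^ 'd) \<Rightarrow>
   (real ^ 'd \<Rightarrow> ereal) \<Rightarrow> real \<Rightarrow> bool" where
  "restricted_prox_PL K \<nu> L f gradf g Fstar \<longleftrightarrow>
     \<nu> > 0 \<and>
     (\<forall>x \<in> K \<inter> eff_dom (composite f g).
        ereal (1 / 2) * gen_grad_size gradf g x L \<ge> ereal \<nu> * (composite f g x - ereal Fstar))"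

end

theory Submission imports Defs
begin

text \<open>The proximal step minimizes over \<open>y\<close> the quadratic model of \<open>F\<close> at \<open>x\<close> that appears in
  \<^const>\<open>gen_grad_size\<close>. By \<open>L\<close>-smoothness the model majorizes \<open>F\<close>, so one step decreases \<open>F\<close> by
  at least \<open>gen_grad_size / (2 * L)\<close>, and the proximal PL inequality turns this into a contraction
  of \<open>F - Fstar\<close> by the factor \<open>1 - \<nu> / L\<close>. That the proximal point exists does not need an affine
  minorant of \<open>g\<close>: the majorization and \<open>F \<ge> Fstar\<close> bound the proximal objective from below, and by
  strong convexity its minimizing sequences are Cauchy.\<close>

text \<open>Restricting to the segment from \<open>x\<close> to \<open>y\<close> makes this a
  one-variable monotonicity statement, so no integral of the gradient appears.\<close>

lemma descent_lemma:
  fixes f :: "'a::real_inner \<Rightarrow> real"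
  assumes grad: "\<And>z. GDERIV f z :> gradf z"
    and smooth: "\<And>y z. norm (gradf y - gradf z) \<le> L * norm (y - z)"
  shows "f y \<le> f x + gradf x \<bullet> (y - x) + L / 2 * (norm (y - x))\<^sup>2"
proof -
  define d where "d = y - x"
  \<comment> \<open>\<open>\<phi>\<close> is \<open>f\<close> on the segment minus the linear and
    quadratic terms of the upper bound; since \<open>\<phi> 0 = f x\<close>, the claim is
    \<open>\<phi> 1 \<le> \<phi> 0\<close>.\<close>
  define \<phi> where "\<phi> t = f (x + t *\<^sub>R d) - t * (gradf x \<bullet> d) - L / 2 * t\<^sup>2 * (norm d)\<^sup>2" for t
  have deriv: "(\<phi> has_real_derivative
      (gradf (x + t *\<^sub>R d) \<bullet> d - gradf x \<bullet> d - L * t * (norm d)\<^sup>2)) (at t)" for t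
  proof -
    have "(f has_derivative (\<lambda>h. h \<bullet> gradf (x + t *\<^sub>R d))) (at (x + t *\<^sub>R d))"
      using grad unfolding gderiv_def .
    moreover have "((\<lambda>t. x + t *\<^sub>R d) has_derivative (\<lambda>h. h *\<^sub>R d)) (at t)"
      by (auto intro!: derivative_eq_intros)
    ultimately have "((\<lambda>t. f (x + t *\<^sub>R d)) has_derivative (\<lambda>h. h *\<^sub>R d \<bullet> gradf (x + t *\<^sub>R d))) (at t)"
      by (rule has_derivative_compose[rotated])
    moreover have "(\<lambda>h. h *\<^sub>R d \<bullet> gradf (x + t *\<^sub>R d)) = (*) (gradf (x + t *\<^sub>R d) \<bullet> d)"
      by (rule ext) (simp add: inner_commute)
    ultimately have [derivative_intros]:
      "((\<lambda>t. f (x + t *\<^sub>R d)) has_real_derivative (gradf (x + t *\<^sub>R d) \<bullet> d)) (at t)"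
      unfolding has_field_derivative_def by simp
    show ?thesis
      unfolding \<phi>_def by (auto intro!: derivative_eq_intros)
  qed
  have nonpos: "gradf (x + t *\<^sub>R d) \<bullet> d - gradf x \<bullet> d - L * t * (norm d)\<^sup>2 \<le> 0" if "0 \<le> t" for t
  proof -
    have "gradf (x + t *\<^sub>R d) \<bullet> d - gradf x \<bullet> d \<le> norm (gradf (x + t *\<^sub>R d) - gradf x) * norm d"
      unfolding inner_diff_left[symmetric] by (rule norm_cauchy_schwarz)
    also have "\<dots> \<le> L * norm (x + t *\<^sub>R d - x) * norm d"
      by (intro mult_right_mono smooth) simp
    finally show ?thesis
      using that by (simp add: power2_eq_square algebra_simps)
  qed
  have "\<phi> 1 \<le> \<phi> 0"
  proof (rule DERIV_nonpos_imp_nonincreasing[where f = \<phi>])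
    show "\<exists>D. (\<phi> has_real_derivative D) (at t) \<and> D \<le> 0" if "0 \<le> t" "t \<le> 1" for t
      using deriv nonpos that(1) by blast
  qed simp
  then show ?thesis
    by (simp add: \<phi>_def d_def)
qed

text \<open>The parallelogram law, read as strong convexity of the squared distance to
  \<open>z\<close>: the midpoint gains a quarter of the squared distance between \<open>a\<close>
  and \<open>b\<close>.\<close>

lemma parallelogram_midpoint:
  fixes a b z :: "'a::real_inner"
  shows "(norm ((1/2) *\<^sub>R a + (1/2) *\<^sub>R b - z))\<^sup>2 =
    ((norm (a - z))\<^sup>2 + (norm (b - z))\<^sup>2) / 2 - (norm (a - b))\<^sup>2 / 4"
  unfolding power2_norm_eq_inner
  by (simp add: inner_diff_left inner_diff_right inner_add_left inner_add_right
      inner_commute field_simps)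

text \<open>Since \<open>prox\<close> is a Hilbert choice, it has the minimizing property once some
  minimizer exists. That one is the limit of a minimizing sequence, which the closed epigraph
  retains.\<close>

lemma prox_is_arg_min:
  fixes g :: "real ^ 'd \<Rightarrow> ereal"
  assumes proper: "proper_fun g" and closed: "closed_fun g" and convex: "convex_fun g"
    and lam: "lam > 0"
    and bound: "\<And>y. ereal B \<le> g y + ereal (1 / (2 * lam) * (norm (y - z))\<^sup>2)"
  shows "is_arg_min (\<lambda>y. g y + ereal (1 / (2 * lam) * (norm (y - z))\<^sup>2)) (\<lambda>_. True) (prox lam g z)"
proof -
  define c where "c = 1 / (2 * lam)"
  have c: "c > 0" using lam by (simp add: c_def)
  \<comment> \<open>Taking values over the epigraph keeps the objective real-valued without changing
    its infimum, and makes convexity and closedness of \<open>epi g\<close> directly usable.\<close>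
  define R where "R = (\<lambda>(y, t). t + c * (norm (y - z))\<^sup>2) ` epi g"
  define m where "m = Inf R"
  obtain y0 where "g y0 < \<infinity>" "g y0 \<noteq> -\<infinity>"
    using proper by (auto simp: proper_fun_def eff_dom_def)
  then have "(y0, real_of_ereal (g y0)) \<in> epi g"
    by (cases "g y0") (auto simp: epi_def)
  then have R_ne: "R \<noteq> {}" by (auto simp: R_def)
  have "B \<le> t + c * (norm (y - z))\<^sup>2" if "(y, t) \<in> epi g" for y t
  proof -
    have "ereal B \<le> g y + ereal (c * (norm (y - z))\<^sup>2)"
      using bound[of y] by (simp add: c_def)
    also have "\<dots> \<le> ereal t + ereal (c * (norm (y - z))\<^sup>2)"
      using that by (intro add_right_mono) (auto simp: epi_def)
    finally show ?thesis by simp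
  qed
  then have bdd: "bdd_below R"
    by (auto simp: R_def intro!: bdd_belowI[of _ B])
  have m_le: "m \<le> t + c * (norm (y - z))\<^sup>2" if "(y, t) \<in> epi g" for y t
    unfolding m_def using that bdd by (intro cInf_lower) (auto simp: R_def intro!: image_eqI[of _ _ "(y, t)"])
  have "\<exists>y t. (y, t) \<in> epi g \<and> t + c * (norm (y - z))\<^sup>2 < m + inverse (real (Suc n))" for n
  proof -
    have "Inf R < m + inverse (real (Suc n))" by (simp add: m_def)
    then show ?thesis
      using R_ne bdd by (subst (asm) cInf_less_iff) (auto simp: R_def)
  qed
  then obtain a s where as: "\<And>n. (a n, s n) \<in> epi g"
      "\<And>n. s n + c * (norm (a n - z))\<^sup>2 < m + inverse (real (Suc n))"
    by metis
  \<comment> \<open>The midpoint of two epigraph points stays in \<open>epi g\<close>, so its value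
    is at least \<open>m\<close>; the parallelogram gain, doubled, must then be covered by the two
    errors.\<close>
  have gap: "c / 2 * (norm (a i - a j))\<^sup>2 \<le> inverse (real (Suc i)) + inverse (real (Suc j))" for i j
  proof -
    have "(1/2) *\<^sub>R (a i, s i) + (1/2) *\<^sub>R (a j, s j) \<in> epi g"
      using convex as(1) unfolding convex_fun_def by (intro convexD) auto
    then have "((1/2) *\<^sub>R a i + (1/2) *\<^sub>R a j, s i / 2 + s j / 2) \<in> epi g"
      by simp
    from m_le[OF this] have "2 * m + c / 2 * (norm (a i - a j))\<^sup>2 \<le>
        (s i + c * (norm (a i - z))\<^sup>2) + (s j + c * (norm (a j - z))\<^sup>2)"
      unfolding parallelogram_midpoint by (simp add: field_simps)
    with as(2)[of i] as(2)[of j] show ?thesis by linarith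
  qed
  have "Cauchy a"
  proof (rule metric_CauchyI)
    fix e :: real assume e: "e > 0"
    obtain N where N: "inverse (real (Suc N)) < c / 4 * e\<^sup>2"
      using reals_Archimedean[of "c / 4 * e\<^sup>2"] c e by auto
    have "dist (a i) (a j) < e" if "i \<ge> N" "j \<ge> N" for i j
    proof -
      have "inverse (real (Suc i)) \<le> inverse (real (Suc N))" "inverse (real (Suc j)) \<le> inverse (real (Suc N))"
        using that by (auto intro!: le_imp_inverse_le)
      with gap[of i j] N have "c / 2 * (norm (a i - a j))\<^sup>2 < c / 2 * e\<^sup>2"
        by linarith
      then have "(norm (a i - a j))\<^sup>2 < e\<^sup>2" using c by simp
      then show ?thesis
        using e by (simp add: dist_norm power2_less_imp_less)
    qed
    then show "\<exists>N. \<forall>i\<ge>N. \<forall>j\<ge>N. dist (a i) (a j) < e" by blast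
  qed
  then obtain p where p: "a \<longlonglongrightarrow> p"
    using Cauchy_convergent_iff convergent_def by blast
  \<comment> \<open>The heights \<open>s n\<close> are not known to converge. Raising each to its
    upper bound stays in the epigraph and gives heights that converge along with
    \<open>a\<close>.\<close>
  have mem: "(a n, m + inverse (real (Suc n)) - c * (norm (a n - z))\<^sup>2) \<in> epi g" for n
  proof -
    have "g (a n) \<le> ereal (s n)" using as(1)[of n] by (simp add: epi_def)
    also have "\<dots> \<le> ereal (m + inverse (real (Suc n)) - c * (norm (a n - z))\<^sup>2)"
      using as(2)[of n] by simp
    finally show ?thesis by (simp add: epi_def)
  qed
  have lim: "(\<lambda>n. (a n, m + inverse (real (Suc n)) - c * (norm (a n - z))\<^sup>2))
      \<longlonglongrightarrow> (p, m + 0 - c * (norm (p - z))\<^sup>2)"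
    by (intro tendsto_intros p LIMSEQ_inverse_real_of_nat)
  have "(p, m + 0 - c * (norm (p - z))\<^sup>2) \<in> epi g"
    using closed_sequentially[OF closed[unfolded closed_fun_def] mem lim] .
  then have "g p \<le> ereal (m - c * (norm (p - z))\<^sup>2)" by (simp add: epi_def)
  then have "g p + ereal (c * (norm (p - z))\<^sup>2) \<le> ereal m"
    by (cases "g p") auto
  moreover have "ereal m \<le> g y + ereal (c * (norm (y - z))\<^sup>2)" for y
  proof (cases "g y")
    case (real r)
    then show ?thesis using m_le[of y r] by (simp add: epi_def)
  qed (use proper in \<open>auto simp: proper_fun_def\<close>)
  ultimately have "is_arg_min (\<lambda>y. g y + ereal (c * (norm (y - z))\<^sup>2)) (\<lambda>_. True) p"
    unfolding is_arg_min_linorder by (blast intro: order_trans)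
  then show ?thesis
    unfolding prox_def arg_min_def c_def by (rule someI)
qed

text \<open>Completing the square: with step size \<open>1 / L\<close> the proximal penalty is the
  quadratic model up to a constant independent of \<open>y\<close>, so adding \<open>g\<close> gives
  both the same minimizers.\<close>

lemma prox_model_completion:
  fixes x y v :: "'a::real_inner"
  assumes "L > 0"
  shows "1 / (2 * (1 / L)) * (norm (y - (x - (1 / L) *\<^sub>R v)))\<^sup>2 =
    v \<bullet> (y - x) + L / 2 * (norm (y - x))\<^sup>2 + (norm v)\<^sup>2 / (2 * L)"
proof -
  have "(norm ((y - x) + (1 / L) *\<^sub>R v))\<^sup>2 =
      (norm (y - x))\<^sup>2 + 2 / L * (v \<bullet> (y - x)) + (norm v)\<^sup>2 / L\<^sup>2"
    unfolding power2_norm_eq_inner inner_add_left inner_add_right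
    by (simp add: inner_commute power2_eq_square)
  moreover have "y - (x - (1 / L) *\<^sub>R v) = (y - x) + (1 / L) *\<^sub>R v" by simp
  ultimately show ?thesis
    using assms by (simp add: field_simps power2_eq_square)
qed

text \<open>The new value is returned as a real \<open>r'\<close>, so that iterating the contraction
  never leaves finite values.\<close>

lemma prox_grad_step:
  fixes f :: "real ^ 'd \<Rightarrow> real"
  assumes grad: "\<And>z. GDERIV f z :> gradf z"
    and L: "L > 0"
    and smooth: "\<And>y z. norm (gradf y - gradf z) \<le> L * norm (y - z)"
    and g: "proper_fun g" "closed_fun g" "convex_fun g"
    and lower: "\<And>y. ereal Fstar \<le> composite f g y"
    and PL: "restricted_prox_PL K \<nu> L f gradf g Fstar"
    and x: "x \<in> K" "composite f g x = ereal r"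
  obtains r' where "composite f g (prox (1 / L) g (x - (1 / L) *\<^sub>R gradf x)) = ereal r'"
    "r' - Fstar \<le> (1 - \<nu> / L) * (r - Fstar)"
proof -
  let ?z = "x - (1 / L) *\<^sub>R gradf x"
  define p where "p = prox (1 / L) g ?z"
  define q where "q y = gradf x \<bullet> (y - x) + L / 2 * (norm (y - x))\<^sup>2" for y
  define C where "C = (norm (gradf x))\<^sup>2 / (2 * L)"
  have sq: "1 / (2 * (1 / L)) * (norm (y - ?z))\<^sup>2 = q y + C" for y
    unfolding q_def C_def using L by (rule prox_model_completion)
  have descent: "f y \<le> f x + q y" for y
    using descent_lemma[OF grad smooth, of y x] by (simp add: q_def)
  have g_not: "g y \<noteq> -\<infinity>" for y using g(1) by (simp add: proper_fun_def)
  obtain \<gamma> where \<gamma>: "g x = ereal \<gamma>" and r: "r = f x + \<gamma>"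
    using x(2) by (cases "g x") (auto simp: composite_def)
  \<comment> \<open>By descent, \<open>q y + g y\<close> is at least \<open>F y - f x\<close>, hence
    at least \<open>Fstar - f x\<close>, where \<open>F\<close> is
    \<open>composite f g\<close>.\<close>
  have "ereal (Fstar - f x + C) \<le> g y + ereal (1 / (2 * (1 / L)) * (norm (y - ?z))\<^sup>2)" for y
    unfolding sq using lower[of y] descent[of y] g_not[of y]
    by (cases "g y") (auto simp: composite_def)
  then have "is_arg_min (\<lambda>y. g y + ereal (1 / (2 * (1 / L)) * (norm (y - ?z))\<^sup>2)) (\<lambda>_. True) p"
    unfolding p_def by (intro prox_is_arg_min g) (use L in auto)
  then have min: "g p + ereal (q p + C) \<le> g y + ereal (q y + C)" for y
    unfolding sq by (simp add: is_arg_min_linorder)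
  \<comment> \<open>Comparison with \<open>y = x\<close>, where the objective is finite, rules out
    \<open>g p = \<infinity>\<close>.\<close>
  obtain \<eta> where \<eta>: "g p = ereal \<eta>"
    using min[of x] \<gamma> g_not[of p] by (cases "g p") auto
  \<comment> \<open>The constant \<open>C\<close> cancels from \<open>min\<close>, so
    \<open>p\<close> attains the infimum in \<open>gen_grad_size\<close>.\<close>
  have "(INF y. ereal (q y) + g y - g x) = ereal (q p + \<eta> - \<gamma>)"
  proof (rule antisym)
    show "(INF y. ereal (q y) + g y - g x) \<le> ereal (q p + \<eta> - \<gamma>)"
      by (rule INF_lower2[of p]) (auto simp: \<eta> \<gamma>)
    show "ereal (q p + \<eta> - \<gamma>) \<le> (INF y. ereal (q y) + g y - g x)"
    proof (rule INF_greatest)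
      fix y
      show "ereal (q p + \<eta> - \<gamma>) \<le> ereal (q y) + g y - g x"
        using min[of y] g_not[of y] by (cases "g y") (auto simp: \<eta> \<gamma>)
    qed
  qed
  then have size: "gen_grad_size gradf g x L = ereal (- 2 * L * (q p + \<eta> - \<gamma>))"
    by (simp add: gen_grad_size_def q_def)
  have "x \<in> K \<inter> eff_dom (composite f g)"
    using x by (simp add: eff_dom_def)
  then have "ereal \<nu> * (composite f g x - ereal Fstar) \<le> ereal (1 / 2) * gen_grad_size gradf g x L"
    using PL unfolding restricted_prox_PL_def by blast
  then have "\<nu> * (r - Fstar) \<le> L * (- (q p + \<eta> - \<gamma>))"
    unfolding size x(2) by (simp add: algebra_simps)
  then have "\<nu> / L * (r - Fstar) \<le> - (q p + \<eta> - \<gamma>)"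
    using L by (metis mult.commute pos_divide_le_eq times_divide_eq_left)
  \<comment> \<open>Descent at \<open>p\<close> bounds the change of \<open>F\<close> by
    \<open>q p + \<eta> - \<gamma>\<close>, which the PL inequality has just bounded above by
    \<open>- \<nu> / L * (r - Fstar)\<close>.\<close>
  with descent[of p] have "f p + \<eta> - Fstar \<le> (1 - \<nu> / L) * (r - Fstar)"
    unfolding r by (simp add: left_diff_distrib)
  moreover have "composite f g p = ereal (f p + \<eta>)"
    by (simp add: composite_def \<eta>)
  ultimately show thesis
    using that unfolding p_def by blast
qed

theorem corollary2:
  fixes f :: "real ^ 'd \<Rightarrow> real"
    and gradf :: "real ^ 'd \<Rightarrow> real ^ 'd"
    and g :: "real ^ 'd \<Rightarrow> ereal"
    and F :: "real ^ 'd \<Rightarrow> ereal"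
    and L \<nu> Fstar :: real
    and K :: "(real ^ 'd) set"
    and x :: "nat \<Rightarrow> real ^ 'd"
    and T :: nat
  assumes F_def: "F = composite f g"
    and grad: "\<And>z. GDERIV f z :> gradf z"
    and grad_cont: "continuous_on UNIV gradf"
    and L_pos: "L > 0"
    and smooth: "\<And>y z. norm (gradf y - gradf z) \<le> L * norm (y - z)"
    and g_proper: "proper_fun g"
    and g_closed: "closed_fun g"
    and g_convex: "convex_fun g"
    and minimizers: "{z. is_arg_min F (\<lambda>_. True) z} \<noteq> {}"
    and min_value: "\<And>z. is_arg_min F (\<lambda>_. True) z \<Longrightarrow> F z = ereal Fstar"
    and PL: "restricted_prox_PL K \<nu> L f gradf g Fstar"
    and iterates: "prox_grad_iterates L gradf g x"
    and in_K: "\<And>k. k \<ge> T \<Longrightarrow> x k \<in> K"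
    and nu_le: "\<nu> \<le> L"
  shows "\<forall>k\<ge>T. F (x k) - ereal Fstar \<le>
           (if F (x T) = \<infinity> then \<infinity>
            else ereal ((1 - \<nu> / L) ^ (k - T)) * (F (x T) - ereal Fstar))"
proof (intro allI impI)
  fix k assume k: "T \<le> k"
  obtain w where w: "is_arg_min F (\<lambda>_. True) w" using minimizers by blast
  then have lower: "ereal Fstar \<le> composite f g y" for y
    using min_value[OF w] F_def by (metis is_arg_min_linorder)
  show "F (x k) - ereal Fstar \<le>
           (if F (x T) = \<infinity> then \<infinity>
            else ereal ((1 - \<nu> / L) ^ (k - T)) * (F (x T) - ereal Fstar))"
  proof (cases "F (x T) = \<infinity>")
    case False
    then obtain r0 where r0: "F (x T) = ereal r0"
      using lower[of "x T"] F_def by (cases "F (x T)") auto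
    \<comment> \<open>Finiteness of \<open>F (x k)\<close> is carried through the induction, because
      the one-step lemma requires it.\<close>
    have "\<exists>r. F (x k) = ereal r \<and> r - Fstar \<le> (1 - \<nu> / L) ^ (k - T) * (r0 - Fstar)"
      using k
    proof (induction k rule: dec_induct)
      case base
      then show ?case using r0 by simp
    next
      case (step n)
      then obtain r where r: "composite f g (x n) = ereal r"
        "r - Fstar \<le> (1 - \<nu> / L) ^ (n - T) * (r0 - Fstar)"
        using F_def by auto
      obtain r' where r': "composite f g (x (Suc n)) = ereal r'"
        "r' - Fstar \<le> (1 - \<nu> / L) * (r - Fstar)"
        using prox_grad_step[OF grad L_pos smooth g_proper g_closed g_convex lower PL in_K r(1)]
          iterates step.hyps unfolding prox_grad_iterates_def by metis
      \<comment> \<open>Multiplying the induction hypothesis by the contraction factor needs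
        \<open>1 - \<nu> / L \<ge> 0\<close>, which is where \<open>\<nu> \<le> L\<close>
        enters.\<close>
      have "(1 - \<nu> / L) * (r - Fstar) \<le> (1 - \<nu> / L) * ((1 - \<nu> / L) ^ (n - T) * (r0 - Fstar))"
        using nu_le L_pos by (intro mult_left_mono r(2)) simp
      with r' show ?case
        using step.hyps F_def by (simp add: Suc_diff_le mult.assoc)
    qed
    then show ?thesis using r0 by auto
  qed simp
qed

end
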